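(* Let $\alpha$ be a non-empty finite set and $\tau$ an involution on $\alpha$. Let $l$ be the number of free orbits of $\alpha$ under $\tau$ (orbits $\{a,\tau(a)\}$ with $a\neq\tau(a)$) and let $k$ be the number of fixed orbits (orbits $\{a\}$ with $a=\tau(a)$). When $S$ is empty, $$G_2(\alpha,\tau,S,1)\cong \mathbb{Z}^{l^2+1}\oplus(\mathbb{Z}/2\mathbb{Z})^{k^2+2kl}.$$ When $S$ is diagonal, i.e. $S=\{(a,a,a)\mid a\in\alpha\}$, $$G_2(\alpha,\tau,S,1)\cong \mathbb{Z}^{l^2-l+1}\oplus(\mathbb{Z}/2\mathbb{Z})^{k^2+2kl-k}.$$ When $S=\alpha\times\alpha\times\alpha$, $$G_2(\alpha,\tau,S,1)\cong \mathbb{Z}\oplus(\mathbb{Z}/2\mathbb{Z})^{k+l-1}.$$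
   Context: A Gauss word is a finite word (possibly empty) in which every letter that occurs occurs exactly twice. A nanoword over $\alpha$ is a Gauss word together with a map $A\mapsto|A|$ from the set of its letters to $\alpha$. Two nanowords are isomorphic if a bijection of their letter sets preserving the map to $\alpha$ carries one word to the other letterwise. The rank of a nanoword is the number of distinct letters in it. An involution is a map $\tau$ with $\tau\circ\tau=\mathrm{id}$. For $S\subseteq\alpha\times\alpha\times\alpha$, $G_2(\alpha,\tau,S,1)$ is the quotient of the free abelian group on isomorphism classes of nanowords over $\alpha$ by the following relations, where $x,y,z,t$ are arbitrary sequences of letters such that all terms are nanowords (and in each relation every letter has the same image in $\alpha$ in all terms in which it appears): (1) $xAAy=0$; (2) $xAByBAz+xAyAz+xByBz=0$ whenever $|A|=\tau(|B|)$; (3) $xAByACzBCt+xAByAzBt+xAyACzCt+xByCzBCt=xBAyCAzCBt+xBAyAzBt+xAyCAzCt+xByCzCBt$ whenever $(|A|,|B|,|C|)\in S$; (4) $p=0$ for every nanoword $p$ of rank greater than $2$. (This group is the image of the universal finite type invariant of degree $2$ for nanowords.) *)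

theory Defs
  imports "HOL-Algebra.Algebra"
begin

definition involution_on :: "'a set \<Rightarrow> ('a \<Rightarrow> 'a) \<Rightarrow> bool" where
  "involution_on \<alpha> \<tau> \<longleftrightarrow> \<tau> \<in> \<alpha> \<rightarrow> \<alpha> \<and> (\<forall>a\<in>\<alpha>. \<tau> (\<tau> a) = a)"

definition free_orbits :: "'a set \<Rightarrow> ('a \<Rightarrow> 'a) \<Rightarrow> 'a set set" where
  "free_orbits \<alpha> \<tau> = {{a, \<tau> a} | a. a \<in> \<alpha> \<and> a \<noteq> \<tau> a}"

definition fixed_orbits :: "'a set \<Rightarrow> ('a \<Rightarrow> 'a) \<Rightarrow> 'a set set" where
  "fixed_orbits \<alpha> \<tau> = {{a} | a. a \<in> \<alpha> \<and> a = \<tau> a}"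

text \<open>Letters are natural numbers. Words are finite and only isomorphism classes matter, so any
  infinite supply of letters gives the same classes.\<close>

definition gauss_word :: "nat list \<Rightarrow> bool" where
  "gauss_word w \<longleftrightarrow> (\<forall>A\<in>set w. count_list w A = 2)"

type_synonym 'a nanoword = "nat list \<times> (nat \<Rightarrow> 'a)"

definition nanowords :: "'a set \<Rightarrow> 'a nanoword set" where
  "nanowords \<alpha> = {(w, p). gauss_word w \<and> p \<in> set w \<rightarrow>\<^sub>E \<alpha>}"

definition nanoword_rank :: "'a nanoword \<Rightarrow> nat" where
  "nanoword_rank N = card (set (fst N))"

definition nanoword_iso :: "'a set \<Rightarrow> 'a nanoword rel" where
  "nanoword_iso \<alpha> = {((w, p), (w', p')). (w, p) \<in> nanowords \<alpha> \<and> (w', p') \<in> nanowords \<alpha> \<and>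
     (\<exists>f. bij_betw f (set w) (set w') \<and> w' = map f w \<and> (\<forall>A\<in>set w. p' (f A) = p A))}"

definition nanoword_free_group :: "'a set \<Rightarrow> ('a nanoword set \<Rightarrow>\<^sub>0 int) monoid" where
  "nanoword_free_group \<alpha> = free_Abelian_group (nanowords \<alpha> // nanoword_iso \<alpha>)"

definition nanoword_gen :: "'a set \<Rightarrow> 'a nanoword \<Rightarrow> 'a nanoword set \<Rightarrow>\<^sub>0 int" where
  "nanoword_gen \<alpha> N = frag_of (nanoword_iso \<alpha> `` {N})"

text \<open>In a relation one labelling \<open>p\<close> of all letters labels every term, by restriction to the
  letters occurring in it; so a letter has the same image in all terms in which it appears.\<close>

definition labelled :: "(nat \<Rightarrow> 'a) \<Rightarrow> nat list \<Rightarrow> 'a nanoword" where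
  "labelled p w = (w, restrict p (set w))"

text \<open>The relators are the differences of the two sides of the relations.\<close>

inductive_set G2_relators ::
  "'a set \<Rightarrow> ('a \<Rightarrow> 'a) \<Rightarrow> ('a \<times> 'a \<times> 'a) set \<Rightarrow> ('a nanoword set \<Rightarrow>\<^sub>0 int) set"
  for \<alpha> :: "'a set" and \<tau> :: "'a \<Rightarrow> 'a" and S :: "('a \<times> 'a \<times> 'a) set"
where
  rel1: "labelled p (x @ [A,A] @ y) \<in> nanowords \<alpha> \<Longrightarrow>
    nanoword_gen \<alpha> (labelled p (x @ [A,A] @ y)) \<in> G2_relators \<alpha> \<tau> S"
| rel2: "\<lbrakk>labelled p (x @ [A,B] @ y @ [B,A] @ z) \<in> nanowords \<alpha>;
     labelled p (x @ [A] @ y @ [A] @ z) \<in> nanowords \<alpha>;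
     labelled p (x @ [B] @ y @ [B] @ z) \<in> nanowords \<alpha>;
     p A = \<tau> (p B)\<rbrakk> \<Longrightarrow>
    nanoword_gen \<alpha> (labelled p (x @ [A,B] @ y @ [B,A] @ z))
    + nanoword_gen \<alpha> (labelled p (x @ [A] @ y @ [A] @ z))
    + nanoword_gen \<alpha> (labelled p (x @ [B] @ y @ [B] @ z)) \<in> G2_relators \<alpha> \<tau> S"
| rel3: "\<lbrakk>labelled p (x @ [A,B] @ y @ [A,C] @ z @ [B,C] @ t) \<in> nanowords \<alpha>;
     labelled p (x @ [A,B] @ y @ [A] @ z @ [B] @ t) \<in> nanowords \<alpha>;
     labelled p (x @ [A] @ y @ [A,C] @ z @ [C] @ t) \<in> nanowords \<alpha>;
     labelled p (x @ [B] @ y @ [C] @ z @ [B,C] @ t) \<in> nanowords \<alpha>;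
     labelled p (x @ [B,A] @ y @ [C,A] @ z @ [C,B] @ t) \<in> nanowords \<alpha>;
     labelled p (x @ [B,A] @ y @ [A] @ z @ [B] @ t) \<in> nanowords \<alpha>;
     labelled p (x @ [A] @ y @ [C,A] @ z @ [C] @ t) \<in> nanowords \<alpha>;
     labelled p (x @ [B] @ y @ [C] @ z @ [C,B] @ t) \<in> nanowords \<alpha>;
     (p A, p B, p C) \<in> S\<rbrakk> \<Longrightarrow>
    (nanoword_gen \<alpha> (labelled p (x @ [A,B] @ y @ [A,C] @ z @ [B,C] @ t))
     + nanoword_gen \<alpha> (labelled p (x @ [A,B] @ y @ [A] @ z @ [B] @ t))
     + nanoword_gen \<alpha> (labelled p (x @ [A] @ y @ [A,C] @ z @ [C] @ t))
     + nanoword_gen \<alpha> (labelled p (x @ [B] @ y @ [C] @ z @ [B,C] @ t)))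
    - (nanoword_gen \<alpha> (labelled p (x @ [B,A] @ y @ [C,A] @ z @ [C,B] @ t))
     + nanoword_gen \<alpha> (labelled p (x @ [B,A] @ y @ [A] @ z @ [B] @ t))
     + nanoword_gen \<alpha> (labelled p (x @ [A] @ y @ [C,A] @ z @ [C] @ t))
     + nanoword_gen \<alpha> (labelled p (x @ [B] @ y @ [C] @ z @ [C,B] @ t))) \<in> G2_relators \<alpha> \<tau> S"
| rel4: "\<lbrakk>N \<in> nanowords \<alpha>; nanoword_rank N > 2\<rbrakk> \<Longrightarrow> nanoword_gen \<alpha> N \<in> G2_relators \<alpha> \<tau> S"

definition G2 ::
  "'a set \<Rightarrow> ('a \<Rightarrow> 'a) \<Rightarrow> ('a \<times> 'a \<times> 'a) set \<Rightarrow> ('a nanoword set \<Rightarrow>\<^sub>0 int) set monoid" where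
  "G2 \<alpha> \<tau> S = nanoword_free_group \<alpha> Mod generate (nanoword_free_group \<alpha>) (G2_relators \<alpha> \<tau> S)"

text \<open>The group \<open>\<int>\<^sup>n \<oplus> (\<int>/2\<int>)\<^sup>m\<close>.\<close>

definition Z_Z2_sum :: "nat \<Rightarrow> nat \<Rightarrow> ((nat \<Rightarrow> int) \<times> (nat \<Rightarrow> int)) monoid" where
  "Z_Z2_sum n m = product_group {..<n} (\<lambda>_. integer_group)
     \<times>\<times> product_group {..<m} (\<lambda>_. integer_mod_group 2)"

text \<open>The quotients above are legitimate: isomorphism is an equivalence relation, and the
  relators generate a normal subgroup.\<close>

lemma equiv_nanoword_iso: "equiv (nanowords \<alpha>) (nanoword_iso \<alpha>)"
proof (rule equivI)
  show "nanoword_iso \<alpha> \<subseteq> nanowords \<alpha> \<times> nanowords \<alpha>"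
    by (auto simp: nanoword_iso_def)
  show "refl_on (nanowords \<alpha>) (nanoword_iso \<alpha>)"
    by (auto simp: refl_on_def nanoword_iso_def intro!: exI[of _ id])
  show "sym (nanoword_iso \<alpha>)"
  proof (rule symI)
    fix M N assume "(M, N) \<in> nanoword_iso \<alpha>"
    then obtain w p w' p' f where MN: "M = (w, p)" "N = (w', p')"
      and nw: "(w, p) \<in> nanowords \<alpha>" "(w', p') \<in> nanowords \<alpha>"
      and f: "bij_betw f (set w) (set w')" "w' = map f w" "\<forall>A\<in>set w. p' (f A) = p A"
      unfolding nanoword_iso_def by blast
    define g where "g = inv_into (set w) f"
    have g: "g (f A) = A" if "A \<in> set w" for A
      using f(1) that by (simp add: g_def bij_betw_inv_into_left)
    have "bij_betw g (set w') (set w)"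
      unfolding g_def by (rule bij_betw_inv_into[OF f(1)])
    moreover have "w = map g w'"
      using g by (simp add: f(2) map_idI)
    moreover have "\<forall>A\<in>set w'. p (g A) = p' A"
      using g f(2,3) by auto
    ultimately show "(N, M) \<in> nanoword_iso \<alpha>"
      using nw unfolding MN nanoword_iso_def by blast
  qed
  show "trans (nanoword_iso \<alpha>)"
  proof (rule transI)
    fix L M N assume "(L, M) \<in> nanoword_iso \<alpha>" "(M, N) \<in> nanoword_iso \<alpha>"
    then obtain u q w p w' p' f g where LMN: "L = (u, q)" "M = (w, p)" "N = (w', p')"
      and nw: "(u, q) \<in> nanowords \<alpha>" "(w', p') \<in> nanowords \<alpha>"
      and f: "bij_betw f (set u) (set w)" "w = map f u" "\<forall>A\<in>set u. p (f A) = q A"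
      and g: "bij_betw g (set w) (set w')" "w' = map g w" "\<forall>A\<in>set w. p' (g A) = p A"
      unfolding nanoword_iso_def by blast
    have "bij_betw (g \<circ> f) (set u) (set w')" "w' = map (g \<circ> f) u"
      "\<forall>A\<in>set u. p' ((g \<circ> f) A) = q A"
      using bij_betw_trans[OF f(1) g(1)] f(2,3) g(2,3) by auto
    then show "(L, N) \<in> nanoword_iso \<alpha>"
      using nw unfolding LMN nanoword_iso_def by blast
  qed
qed

lemma G2_relators_subset: "G2_relators \<alpha> \<tau> S \<subseteq> carrier (nanoword_free_group \<alpha>)"
proof -
  have gen: "nanoword_gen \<alpha> N \<in> carrier (nanoword_free_group \<alpha>)" if "N \<in> nanowords \<alpha>" for N
    using that by (simp add: nanoword_gen_def nanoword_free_group_def quotientI)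
  have add: "a + b \<in> carrier (nanoword_free_group \<alpha>)" and sub: "a - b \<in> carrier (nanoword_free_group \<alpha>)"
    if "a \<in> carrier (nanoword_free_group \<alpha>)" "b \<in> carrier (nanoword_free_group \<alpha>)" for a b
    using that keys_add[of a b] keys_diff[of a b]
    by (auto simp: nanoword_free_group_def free_Abelian_group_def)
  show ?thesis
  proof
    fix r assume "r \<in> G2_relators \<alpha> \<tau> S"
    then show "r \<in> carrier (nanoword_free_group \<alpha>)"
      by cases (auto intro!: gen add sub)
  qed
qed

lemma normal_G2_relators:
  "generate (nanoword_free_group \<alpha>) (G2_relators \<alpha> \<tau> S) \<lhd> nanoword_free_group \<alpha>"
proof -
  interpret comm_group "nanoword_free_group \<alpha>"
    by (simp add: nanoword_free_group_def abelian_free_Abelian_group)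
  show ?thesis
    by (rule subgroup_imp_normal[OF generate_is_subgroup[OF G2_relators_subset]])
qed

end

theory Submission
  imports Defs
begin

text \<open>A Gauss word of rank at most two is empty or, up to renaming, one of \<open>AA\<close>, \<open>AABB\<close>,
  \<open>ABBA\<close>, \<open>ABAB\<close>. The words with two equal neighbours vanish; among them is \<open>ABBA\<close>. So the group is generated
  by the empty word and the classes \<open>X a b = interlaced \<alpha> a b\<close> of \<open>ABAB\<close> with \<open>A\<close> labelled \<open>a\<close> and \<open>B\<close>
  labelled \<open>b\<close>. A relation of the second kind is
  non-trivial only if exactly one further letter occurs and interlaces with each of the two; then it says
  \<open>X (\<tau> a) b + X a b = 0\<close> or \<open>X b (\<tau> a) + X b a = 0\<close>. A relation of the third kind
  is non-trivial only if there is no further letter; then it says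
  \<open>X a b + X b c = X a c\<close> for \<open>(a, b, c) \<in> S\<close>.

  Hence the empty word spans a free summand, and the \<open>X a b\<close> span, when \<open>S\<close> is empty, the
  tensor square of the abelian group generated by \<open>\<alpha>\<close> with relations \<open>a + \<tau> a = 0\<close>.
  That group has a copy of the integers for each free orbit and a copy of the group of order two for each fixed
  orbit, which gives the first formula. When \<open>S\<close> is diagonal, the triangle relation reads \<open>X a a = 0\<close> and
  kills the diagonal of the tensor square. When \<open>S\<close> is everything, fix a base point \<open>z\<close>. Then
  \<open>X a b = X z b - X z a\<close>, the shift relations give \<open>2 X z a = 0\<close> and
  \<open>X z (\<tau> a) = X z a\<close>, and a copy of the group of order two remains for every orbit other than that of
  \<open>z\<close>.

  To make this a proof, each claimed basis element receives a coordinate: an integral linear form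
  on the free group that is dual to the basis and that sends every relator to zero, or to an even number in
  the torsion case (\<open>coordinate_relator\<close>). Conversely every generator equals, modulo
  the relators, the combination of basis elements that its coordinates prescribe. These two facts are
  combined in \<open>quotient_iso_Z_Z2_sum\<close> and \<open>G2_iso_of_coordinates\<close>; the three cases
  then differ only in the basis and the formula for the coordinates
  (\<open>G2_iso_signed\<close> and \<open>G2_iso_full\<close>).\<close>

section \<open>Linear forms on free abelian groups\<close>

definition linear_ext :: "('c \<Rightarrow> int) \<Rightarrow> ('c \<Rightarrow>\<^sub>0 int) \<Rightarrow> int" where
  "linear_ext u x = (\<Sum>k\<in>Poly_Mapping.keys x. Poly_Mapping.lookup x k * u k)"

lemma linear_ext_superset:
  assumes "finite K" "Poly_Mapping.keys x \<subseteq> K"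
  shows "linear_ext u x = (\<Sum>k\<in>K. Poly_Mapping.lookup x k * u k)"
  unfolding linear_ext_def
  by (rule sum.mono_neutral_left) (use assms in \<open>auto simp: in_keys_iff\<close>)

lemma linear_ext_add: "linear_ext u (x + y) = linear_ext u x + linear_ext u y"
proof -
  define K where "K = Poly_Mapping.keys x \<union> Poly_Mapping.keys y"
  have "finite K" "Poly_Mapping.keys (x + y) \<subseteq> K" by (auto simp: K_def dest: subsetD[OF keys_add])
  moreover have "Poly_Mapping.keys x \<subseteq> K" "Poly_Mapping.keys y \<subseteq> K" by (auto simp: K_def)
  ultimately show ?thesis
    by (simp add: linear_ext_superset[of K] lookup_add algebra_simps sum.distrib)
qed

lemma linear_ext_frag_of [simp]: "linear_ext u (frag_of k) = u k"
  by (simp add: linear_ext_def)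

lemma additive_zero:
  fixes h :: "('c \<Rightarrow>\<^sub>0 int) \<Rightarrow> int"
  assumes "\<And>x y. h (x + y) = h x + h y"
  shows "h 0 = 0"
  using assms[of 0 0] by simp

lemma additive_diff:
  fixes h :: "('c \<Rightarrow>\<^sub>0 int) \<Rightarrow> int"
  assumes "\<And>x y. h (x + y) = h x + h y"
  shows "h (x - y) = h x - h y"
  using assms[of "x - y" y] by simp

lemma additive_cmul:
  fixes h :: "('c \<Rightarrow>\<^sub>0 int) \<Rightarrow> int"
  assumes add: "\<And>x y. h (x + y) = h x + h y"
  shows "h (frag_cmul n x) = n * h x"
proof (induction n)
  case (nonneg n)
  show ?case
    by (induction n) (auto simp: frag_cmul_distrib add additive_zero[OF add] algebra_simps)
next
  case (neg n)
  have pos: "h (frag_cmul (int m) x) = int m * h x" for m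
    by (induction m) (auto simp: frag_cmul_distrib add additive_zero[OF add] algebra_simps)
  have "h (frag_cmul (- int (Suc n)) x) = h (0 - frag_cmul (int (Suc n)) x)"
    by (metis diff_0 minus_frag_cmul)
  also have "\<dots> = - int (Suc n) * h x"
    unfolding additive_diff[where h = h, OF add] additive_zero[where h = h, OF add] pos
    by (simp add: left_diff_distrib distrib_right)
  finally show ?case .
qed

lemma additive_sum:
  fixes h :: "('c \<Rightarrow>\<^sub>0 int) \<Rightarrow> int"
  assumes add: "\<And>x y. h (x + y) = h x + h y"
  shows "h (\<Sum>i\<in>I. f i) = (\<Sum>i\<in>I. h (f i))"
  by (induction I rule: infinite_finite_induct) (auto simp: add additive_zero[OF add])

lemma subgroup_zero:
  assumes "subgroup N (free_Abelian_group B)"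
  shows "0 \<in> N"
  using subgroup.one_closed[OF assms] by simp

lemma subgroup_add:
  assumes "subgroup N (free_Abelian_group B)" "x \<in> N" "y \<in> N"
  shows "x + y \<in> N"
  using subgroup.m_closed[OF assms] by simp

lemma subgroup_cmul:
  assumes "subgroup N (free_Abelian_group B)" "x \<in> N"
  shows "frag_cmul n x \<in> N"
  using group.subgroup_int_pow_closed[OF group_free_Abelian_group assms, of n]
    subgroup.subset[OF assms(1)] assms(2) by auto

lemma subgroup_diff:
  assumes N: "subgroup N (free_Abelian_group B)" and "x \<in> N" "y \<in> N"
  shows "x - y \<in> N"
  using subgroup_add[OF N \<open>x \<in> N\<close> subgroup_cmul[OF N \<open>y \<in> N\<close>, of "-1"]] by simp

lemma subgroup_sum:
  assumes N: "subgroup N (free_Abelian_group B)" and "\<And>i. i \<in> A \<Longrightarrow> f i \<in> N"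
  shows "sum f A \<in> N"
  using assms(2)
  by (induction A rule: infinite_finite_induct) (auto simp: subgroup_zero[OF N] subgroup_add[OF N])

lemma frag_cmul_2: "frag_cmul 2 x = x + x"
  using frag_cmul_distrib[of 1 1 x] by simp

text \<open>The basis \<open>g\<close> and the dual forms \<open>\<phi>\<close> determine the quotient: the map sending
  \<open>x\<close> to its coordinates, those indexed by \<open>J\<close> reduced modulo two, is onto because of
  duality. If it kills \<open>x\<close>, then each term of the expansion of \<open>x\<close> lies in \<open>N\<close>, being zero
  or a multiple of some \<open>2 g j\<close>. Hence its kernel is exactly \<open>N\<close>.\<close>

lemma quotient_iso_Z_Z2_sum:
  fixes \<phi> :: "'i \<Rightarrow> ('c \<Rightarrow>\<^sub>0 int) \<Rightarrow> int" and g :: "'i \<Rightarrow> ('c \<Rightarrow>\<^sub>0 int)"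
  assumes N: "subgroup N (free_Abelian_group B)"
    and fin: "finite I" "finite J" and disj: "I \<inter> J = {}"
    and add: "\<And>i x y. \<phi> i (x + y) = \<phi> i x + \<phi> i y"
    and g: "\<And>i. i \<in> I \<union> J \<Longrightarrow> g i \<in> carrier (free_Abelian_group B)"
    and dual: "\<And>i j. i \<in> I \<union> J \<Longrightarrow> j \<in> I \<union> J \<Longrightarrow> \<phi> i (g j) = of_bool (i = j)"
    and I: "\<And>i x. i \<in> I \<Longrightarrow> x \<in> N \<Longrightarrow> \<phi> i x = 0"
    and J: "\<And>j x. j \<in> J \<Longrightarrow> x \<in> N \<Longrightarrow> even (\<phi> j x)"
    and expand: "\<And>x. x \<in> carrier (free_Abelian_group B) \<Longrightarrow>
      x - (\<Sum>i\<in>I \<union> J. frag_cmul (\<phi> i x) (g i)) \<in> N"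
    and torsion: "\<And>j. j \<in> J \<Longrightarrow> frag_cmul 2 (g j) \<in> N"
  shows "free_Abelian_group B Mod N \<cong> Z_Z2_sum (card I) (card J)"
proof -
  let ?F = "free_Abelian_group B" and ?n = "card I" and ?m = "card J"
  let ?T = "Z_Z2_sum ?n ?m"
  obtain e where e: "bij_betw e {..<?n} I"
    using ex_bij_betw_nat_finite[OF fin(1)] by (auto simp: atLeast0LessThan)
  obtain e' where e': "bij_betw e' {..<?m} J"
    using ex_bij_betw_nat_finite[OF fin(2)] by (auto simp: atLeast0LessThan)
  have eI: "e i \<in> I" if "i < ?n" for i using e that by (auto simp: bij_betw_def)
  have eJ: "e' i \<in> J" if "i < ?m" for i using e' that by (auto simp: bij_betw_def)
  define \<Phi> where "\<Phi> x = (\<lambda>i\<in>{..<?n}. \<phi> (e i) x, \<lambda>j\<in>{..<?m}. \<phi> (e' j) x mod 2)" for x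
  have carr: "carrier ?T = ({..<?n} \<rightarrow>\<^sub>E UNIV) \<times> ({..<?m} \<rightarrow>\<^sub>E {0..<2})"
    by (simp add: Z_Z2_sum_def carrier_integer_mod_group integer_group_def)
  have grpT: "group ?T"
    unfolding Z_Z2_sum_def by (intro DirProd_group product_group) auto
  have hom: "\<Phi> \<in> hom ?F ?T"
  proof (rule homI)
    fix x show "\<Phi> x \<in> carrier ?T" by (auto simp: \<Phi>_def carr)
    fix y show "\<Phi> (x \<otimes>\<^bsub>?F\<^esub> y) = \<Phi> x \<otimes>\<^bsub>?T\<^esub> \<Phi> y"
      by (auto simp: \<Phi>_def Z_Z2_sum_def add mod_simps integer_group_def fun_eq_iff)
  qed
  interpret group_hom ?F ?T \<Phi>
    using hom grpT by (simp add: group_hom_def group_hom_axioms_def)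
  have oneT: "\<one>\<^bsub>?T\<^esub> = (\<lambda>i\<in>{..<?n}. 0, \<lambda>j\<in>{..<?m}. 0)"
    by (simp add: Z_Z2_sum_def integer_group_def)
  have null: "\<Phi> x = \<one>\<^bsub>?T\<^esub> \<longleftrightarrow> (\<forall>i\<in>I. \<phi> i x = 0) \<and> (\<forall>j\<in>J. even (\<phi> j x))" for x
  proof -
    have "\<Phi> x = \<one>\<^bsub>?T\<^esub> \<longleftrightarrow> (\<forall>i\<in>{..<?n}. \<phi> (e i) x = 0) \<and> (\<forall>j\<in>{..<?m}. even (\<phi> (e' j) x))"
      unfolding oneT \<Phi>_def by (auto simp: fun_eq_iff restrict_def even_iff_mod_2_eq_zero)
    also have "\<dots> \<longleftrightarrow> (\<forall>i\<in>e ` {..<?n}. \<phi> i x = 0) \<and> (\<forall>j\<in>e' ` {..<?m}. even (\<phi> j x))"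
      by simp
    finally show ?thesis unfolding bij_betw_imp_surj_on[OF e] bij_betw_imp_surj_on[OF e'] .
  qed
  have "kernel ?F ?T \<Phi> = N"
  proof
    show "N \<subseteq> kernel ?F ?T \<Phi>"
      using subgroup.subset[OF N] I J unfolding kernel_def null by blast
    show "kernel ?F ?T \<Phi> \<subseteq> N"
    proof
      fix x assume x: "x \<in> kernel ?F ?T \<Phi>"
      have "(\<Sum>i\<in>I \<union> J. frag_cmul (\<phi> i x) (g i)) \<in> N"
      proof (rule subgroup_sum[OF N])
        fix i assume "i \<in> I \<union> J"
        then consider "\<phi> i x = 0" | "i \<in> J" "even (\<phi> i x)"
          using x by (auto simp: kernel_def null)
        then show "frag_cmul (\<phi> i x) (g i) \<in> N"
        proof cases
          case 1 then show ?thesis using subgroup_zero[OF N] by simp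
        next
          case 2
          then obtain n where "\<phi> i x = n * 2" by (auto elim: evenE)
          then have "frag_cmul (\<phi> i x) (g i) = frag_cmul n (frag_cmul 2 (g i))" by simp
          then show ?thesis using subgroup_cmul[OF N torsion[OF 2(1)]] by metis
        qed
      qed
      moreover have "x - (\<Sum>i\<in>I \<union> J. frag_cmul (\<phi> i x) (g i)) \<in> N"
        using x by (intro expand) (simp add: kernel_def)
      ultimately show "x \<in> N" using subgroup_add[OF N] by fastforce
    qed
  qed
  moreover have "\<Phi> ` carrier ?F = carrier ?T"
  proof
    show "\<Phi> ` carrier ?F \<subseteq> carrier ?T" by auto
    show "carrier ?T \<subseteq> \<Phi> ` carrier ?F"
    proof
      fix t assume t: "t \<in> carrier ?T"
      \<comment> \<open>The entries of the target tuple, carried back to the index sets by the enumerations.\<close>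
      define c where "c i = (if i \<in> I then fst t (the_inv_into {..<?n} e i)
        else snd t (the_inv_into {..<?m} e' i))" for i
      define x where "x = (\<Sum>i\<in>I \<union> J. frag_cmul (c i) (g i))"
      have "frag_cmul (c i) (g i) \<in> carrier ?F" if "i \<in> I \<union> J" for i
        using g[OF that] keys_cmul[of "c i" "g i"] by auto
      then have x: "x \<in> carrier ?F"
        unfolding x_def by (intro sum_closed_free_Abelian_group) auto
      have \<phi>x: "\<phi> i x = c i" if "i \<in> I \<union> J" for i
      proof -
        have "\<phi> i x = (\<Sum>j\<in>I \<union> J. c j * \<phi> i (g j))"
          by (simp add: x_def additive_sum[where h = "\<phi> i", OF add] additive_cmul[where h = "\<phi> i", OF add])
        also have "\<dots> = (\<Sum>j\<in>I \<union> J. if i = j then c j else 0)"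
          by (intro sum.cong) (auto simp: dual[OF that])
        also have "\<dots> = c i" using that fin by (auto simp: sum.delta)
        finally show ?thesis .
      qed
      have c1: "c (e i) = fst t i" if "i < ?n" for i
        using e that eI[OF that] by (auto simp: c_def bij_betw_def the_inv_into_f_f)
      have c2: "c (e' j) = snd t j" if "j < ?m" for j
        using e' that eJ[OF that] disj by (auto simp: c_def bij_betw_def the_inv_into_f_f)
      obtain t1 t2 where t12: "t = (t1, t2)" by (cases t)
      have t1: "t1 \<in> {..<?n} \<rightarrow>\<^sub>E UNIV" and t2: "t2 \<in> {..<?m} \<rightarrow>\<^sub>E {0..<2}"
        using t unfolding t12 carr by auto
      have "t2 j mod 2 = t2 j" if "j < ?m" for j
        using PiE_mem[OF t2, of j] that by auto
      then have "\<Phi> x = t"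
        using t1 t2 unfolding \<Phi>_def t12
        by (auto simp: fun_eq_iff restrict_def \<phi>x eI eJ c1 c2 t12 PiE_def extensional_def)
      then show "t \<in> \<Phi> ` carrier ?F" using x by blast
    qed
  qed
  ultimately show ?thesis using FactGroup_iso by metis
qed

section \<open>Linear forms compatible with the relations\<close>

text \<open>All the linear forms needed below depend on a word through its interlacing pattern only: they
  give \<open>c\<close> on the empty word, \<open>f a b\<close> on \<open>ABAB\<close> and zero on every other word. For Gauss
  words the index condition forces two distinct letters.\<close>

definition gauss_value :: "int \<Rightarrow> ('a \<Rightarrow> 'a \<Rightarrow> int) \<Rightarrow> 'a nanoword \<Rightarrow> int" where
  "gauss_value c f N = (case N of (w, p) \<Rightarrow>
     if w = [] then c
     else if length w = 4 \<and> w ! 0 = w ! 2 \<and> w ! 1 = w ! 3 then f (p (w ! 0)) (p (w ! 1))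
     else 0)"

lemma gauss_value_labelled:
  "gauss_value c f (labelled p w) =
    (if w = [] then c
     else if length w = 4 \<and> w ! 0 = w ! 2 \<and> w ! 1 = w ! 3 then f (p (w ! 0)) (p (w ! 1))
     else 0)"
  by (auto simp: gauss_value_def labelled_def)

lemma gauss_value_length:
  assumes "w \<noteq> []" "length w \<noteq> 4"
  shows "gauss_value c f (labelled p w) = 0"
  using assms by (simp add: gauss_value_labelled)

lemma gauss_value_iso:
  assumes "(M, N) \<in> nanoword_iso \<alpha>"
  shows "gauss_value c f M = gauss_value c f N"
proof -
  obtain w p w' p' h where MN: "M = (w, p)" "N = (w', p')"
    and h: "inj_on h (set w)" "w' = map h w" "\<forall>A\<in>set w. p' (h A) = p A"
    using assms unfolding nanoword_iso_def bij_betw_def by blast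
  have "h (w ! i) = h (w ! j) \<longleftrightarrow> w ! i = w ! j" if "i < length w" "j < length w" for i j
    using h(1) that by (auto simp: inj_on_def)
  moreover have "p' (h (w ! i)) = p (w ! i)" if "i < length w" for i
    using h(3) that by simp
  ultimately show ?thesis by (auto simp: MN gauss_value_def h(2))
qed

text \<open>The chosen representative of a class is irrelevant: the value is an
  isomorphism invariant (\<open>gauss_value_iso\<close>).\<close>

definition coordinate :: "int \<Rightarrow> ('a \<Rightarrow> 'a \<Rightarrow> int) \<Rightarrow> ('a nanoword set \<Rightarrow>\<^sub>0 int) \<Rightarrow> int" where
  "coordinate c f = linear_ext (\<lambda>C. gauss_value c f (SOME N. N \<in> C))"

lemma coordinate_add: "coordinate c f (x + y) = coordinate c f x + coordinate c f y"
  by (simp add: coordinate_def linear_ext_add)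

lemma coordinate_diff: "coordinate c f (x - y) = coordinate c f x - coordinate c f y"
  by (rule additive_diff[where h = "coordinate c f", OF coordinate_add])

lemma coordinate_gen:
  assumes "N \<in> nanowords \<alpha>"
  shows "coordinate c f (nanoword_gen \<alpha> N) = gauss_value c f N"
proof -
  have "N \<in> nanoword_iso \<alpha> `` {N}"
    by (rule equiv_class_self[OF equiv_nanoword_iso assms])
  then have "(SOME M. M \<in> nanoword_iso \<alpha> `` {N}) \<in> nanoword_iso \<alpha> `` {N}"
    by (rule someI)
  then have "(N, SOME M. M \<in> nanoword_iso \<alpha> `` {N}) \<in> nanoword_iso \<alpha>"
    by blast
  from gauss_value_iso[OF this, of c f] show ?thesis
    by (simp add: coordinate_def nanoword_gen_def)
qed

text \<open>The consequences of the second and third relations for \<open>ABAB\<close>, read modulo \<open>d\<close>.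
  With \<open>d = 0\<close> divisibility is equality to zero, so that one notion serves the free and the torsion
  coordinates.\<close>

definition respects_moves ::
  "'a set \<Rightarrow> ('a \<Rightarrow> 'a) \<Rightarrow> ('a \<times> 'a \<times> 'a) set \<Rightarrow> int \<Rightarrow> ('a \<Rightarrow> 'a \<Rightarrow> int) \<Rightarrow> bool" where
  "respects_moves \<alpha> \<tau> S d f \<longleftrightarrow>
     (\<forall>a\<in>\<alpha>. \<forall>b\<in>\<alpha>. d dvd f (\<tau> a) b + f a b \<and> d dvd f b (\<tau> a) + f b a) \<and>
     (\<forall>a\<in>\<alpha>. \<forall>b\<in>\<alpha>. \<forall>c\<in>\<alpha>. (a, b, c) \<in> S \<longrightarrow> d dvd f a b + f b c - f a c)"

lemma three_lists_of_total_length_2: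
  assumes "length x + length y + length z = 2"
  obtains (xx) u v where "x = [u,v]" "y = []" "z = []"
    | (yy) u v where "x = []" "y = [u,v]" "z = []"
    | (zz) u v where "x = []" "y = []" "z = [u,v]"
    | (xy) u v where "x = [u]" "y = [v]" "z = []"
    | (xz) u v where "x = [u]" "y = []" "z = [v]"
    | (yz) u v where "x = []" "y = [u]" "z = [v]"
  using assms
  by (cases x; cases "tl x"; cases y; cases "tl y"; cases z; cases "tl z"; auto)

text \<open>Only words of length four matter, so in the second relation exactly one letter, occurring twice,
  may surround \<open>A\<close> and \<open>B\<close>, and in the third none. In the second relation the two
  surrounding occurrences interlace with \<open>A\<close> precisely if exactly one of them lies in \<open>y\<close>, and then they
  interlace with \<open>B\<close> as well: the two values that arise are those paired in \<open>respects_moves\<close>.\<close>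

lemma coordinate_relator:
  assumes f: "respects_moves \<alpha> \<tau> S d f" and r: "r \<in> G2_relators \<alpha> \<tau> S"
  shows "d dvd coordinate c f r"
  using r
proof cases
  case (rel1 p x A y)
  let ?w = "x @ [A,A] @ y"
  have g: "count_list ?w A = 2" "?w \<noteq> []"
    using rel1 by (auto simp: labelled_def nanowords_def gauss_word_def)
  have "\<not> (length ?w = 4 \<and> ?w ! 0 = ?w ! 2 \<and> ?w ! 1 = ?w ! 3)"
  proof
    assume *: "length ?w = 4 \<and> ?w ! 0 = ?w ! 2 \<and> ?w ! 1 = ?w ! 3"
    then have "length x + length y + length [] = 2" by auto
    then show False using * g by (cases rule: three_lists_of_total_length_2) (auto split: if_splits)
  qed
  then have "gauss_value c f (labelled p ?w) = 0"
    unfolding gauss_value_labelled using g(2) by presburger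
  then show ?thesis using rel1 by (simp add: coordinate_gen)
next
  case (rel2 p x A B y z)
  let ?v = "gauss_value c f"
  have c: "coordinate c f r = ?v (labelled p (x @ [A,B] @ y @ [B,A] @ z))
      + ?v (labelled p (x @ [A] @ y @ [A] @ z)) + ?v (labelled p (x @ [B] @ y @ [B] @ z))"
    using rel2 by (simp only: coordinate_add coordinate_gen)
  have g: "count_list (x @ [A,B] @ y @ [B,A] @ z) A = 2" "count_list (x @ [A,B] @ y @ [B,A] @ z) B = 2"
    and p: "\<And>u. u \<in> set x \<union> set y \<union> set z \<union> {A,B} \<Longrightarrow> p u \<in> \<alpha>"
    using rel2 by (auto simp: labelled_def nanowords_def gauss_word_def)
  have AB: "A \<noteq> B" using g(1) by auto
  with g have "count_list x A = 0" "count_list y A = 0" "count_list z A = 0"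
    "count_list x B = 0" "count_list y B = 0" "count_list z B = 0" by auto
  then have new: "A \<notin> set (x @ y @ z)" "B \<notin> set (x @ y @ z)"
    by (auto simp: count_list_0_iff)
  have fd: "d dvd f (p A) b + f (p B) b" "d dvd f b (p A) + f b (p B)" if "b \<in> \<alpha>" for b
    using f p[of B] that unfolding rel2(5) by (auto simp: respects_moves_def)
  consider "length x + length y + length z = 0" | "length x + length y + length z = 2"
    | "length x + length y + length z \<noteq> 0" "length x + length y + length z \<noteq> 2" by blast
  then show ?thesis
  proof cases
    case 1
    then show ?thesis using AB by (simp add: c gauss_value_labelled)
  next
    case 2
    then show ?thesis using new fd p
      by (cases rule: three_lists_of_total_length_2) (auto simp: c gauss_value_labelled)
  next
    case 3
    then have "coordinate c f r = 0 + 0 + 0"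
      unfolding c by (intro arg_cong2[where f = "(+)"] gauss_value_length; simp; linarith)
    then show ?thesis by simp
  qed
next
  case (rel3 p x A B y C z t)
  let ?v = "gauss_value c f"
  note gen = rel3(2-9)[THEN coordinate_gen, of c f]
  have c: "coordinate c f r =
      (?v (labelled p (x @ [A,B] @ y @ [A,C] @ z @ [B,C] @ t))
       + ?v (labelled p (x @ [A,B] @ y @ [A] @ z @ [B] @ t))
       + ?v (labelled p (x @ [A] @ y @ [A,C] @ z @ [C] @ t))
       + ?v (labelled p (x @ [B] @ y @ [C] @ z @ [B,C] @ t)))
      - (?v (labelled p (x @ [B,A] @ y @ [C,A] @ z @ [C,B] @ t))
       + ?v (labelled p (x @ [B,A] @ y @ [A] @ z @ [B] @ t))
       + ?v (labelled p (x @ [A] @ y @ [C,A] @ z @ [C] @ t))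
       + ?v (labelled p (x @ [B] @ y @ [C] @ z @ [C,B] @ t)))"
    unfolding rel3(1) coordinate_add coordinate_diff gen ..
  let ?w = "x @ [A,B] @ y @ [A,C] @ z @ [B,C] @ t"
  have g: "count_list ?w A = 2" "count_list ?w B = 2" "count_list ?w C = 2"
    and p: "p A \<in> \<alpha>" "p B \<in> \<alpha>" "p C \<in> \<alpha>"
    using rel3(2) by (auto simp: labelled_def nanowords_def gauss_word_def)
  have ABC: "A \<noteq> B" "A \<noteq> C" "B \<noteq> C"
    using g by (auto split: if_splits)
  show ?thesis
  proof (cases "x @ y @ z @ t = []")
    case True
    then show ?thesis using f p ABC rel3(10)
      by (auto simp: c gauss_value_labelled respects_moves_def)
  next
    case False
    then have "length x + length y + length z + length t \<noteq> 0" by auto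
    then have "coordinate c f r = (0 + 0 + 0 + 0) - (0 + 0 + 0 + 0)"
      unfolding c
      by (intro arg_cong2[where f = "(+)"] arg_cong2[where f = "(-)"] gauss_value_length;
          simp; linarith)
    then show ?thesis by simp
  qed
next
  case (rel4 N)
  obtain w p where N: "N = (w, p)" by (cases N)
  have "\<not> (length w = 4 \<and> w ! 0 = w ! 2 \<and> w ! 1 = w ! 3)"
  proof
    assume *: "length w = 4 \<and> w ! 0 = w ! 2 \<and> w ! 1 = w ! 3"
    then obtain A B where "w = [A,B,A,B]" by (auto simp: length_Suc_conv numeral_eq_Suc)
    then have "nanoword_rank N \<le> 2" by (simp add: N nanoword_rank_def card_insert_if)
    then show False using rel4 by simp
  qed
  moreover have "w \<noteq> []" using rel4 by (auto simp: N nanoword_rank_def)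
  ultimately have "gauss_value c f N = 0" unfolding gauss_value_def N by auto
  then show ?thesis using rel4 by (simp add: coordinate_gen)
qed

definition relation_subgroup ::
  "'a set \<Rightarrow> ('a \<Rightarrow> 'a) \<Rightarrow> ('a \<times> 'a \<times> 'a) set \<Rightarrow> ('a nanoword set \<Rightarrow>\<^sub>0 int) set" where
  "relation_subgroup \<alpha> \<tau> S = generate (nanoword_free_group \<alpha>) (G2_relators \<alpha> \<tau> S)"

lemma subgroup_relation_subgroup:
  "subgroup (relation_subgroup \<alpha> \<tau> S) (free_Abelian_group (nanowords \<alpha> // nanoword_iso \<alpha>))"
  using normal_imp_subgroup[OF normal_G2_relators[of \<alpha> \<tau> S]]
  by (simp add: relation_subgroup_def nanoword_free_group_def)

lemma relator_in_relation_subgroup: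
  "r \<in> G2_relators \<alpha> \<tau> S \<Longrightarrow> r \<in> relation_subgroup \<alpha> \<tau> S"
  unfolding relation_subgroup_def by (rule generate.incl)

lemma coordinate_relation_subgroup:
  assumes f: "respects_moves \<alpha> \<tau> S d f" and r: "r \<in> relation_subgroup \<alpha> \<tau> S"
  shows "d dvd coordinate c f r"
  using r unfolding relation_subgroup_def
proof (induction rule: generate.induct)
  case one
  show ?case
    by (simp add: nanoword_free_group_def additive_zero[where h = "coordinate c f", OF coordinate_add])
next
  case (incl h)
  then show ?case by (rule coordinate_relator[OF f])
next
  case (inv h)
  then have "h \<in> carrier (nanoword_free_group \<alpha>)" using G2_relators_subset by blast
  then have "coordinate c f (inv\<^bsub>nanoword_free_group \<alpha>\<^esub> h) = - coordinate c f h"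
    using coordinate_diff[of c f 0 h]
    by (simp add: nanoword_free_group_def additive_zero[where h = "coordinate c f", OF coordinate_add])
  then show ?case using coordinate_relator[OF f inv] by simp
next
  case (eng h1 h2)
  then show ?case by (simp add: nanoword_free_group_def coordinate_add)
qed

section \<open>Nanowords modulo the relations\<close>

definition interlaced :: "'a set \<Rightarrow> 'a \<Rightarrow> 'a \<Rightarrow> 'a nanoword set \<Rightarrow>\<^sub>0 int" where
  "interlaced \<alpha> a b = nanoword_gen \<alpha> (labelled (\<lambda>n. if n = 0 then a else b) [0,1,0,1])"

lemma nanoword_gen_interlaced:
  assumes "A \<noteq> B" "p A \<in> \<alpha>" "p B \<in> \<alpha>"
  shows "nanoword_gen \<alpha> (labelled p [A,B,A,B]) = interlaced \<alpha> (p A) (p B)"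
proof -
  have "(labelled p [A,B,A,B], labelled (\<lambda>n. if n = 0 then p A else p B) [0,1,0,1]) \<in> nanoword_iso \<alpha>"
    using assms
    by (auto simp: nanoword_iso_def labelled_def nanowords_def gauss_word_def bij_betw_def inj_on_def
        intro!: exI[of _ "\<lambda>n. if n = A then 0 else 1"])
  then show ?thesis
    unfolding interlaced_def nanoword_gen_def
    by (intro arg_cong[where f = frag_of] equiv_class_eq[OF equiv_nanoword_iso])
qed

lemma interlaced_carrier:
  assumes "a \<in> \<alpha>" "b \<in> \<alpha>"
  shows "interlaced \<alpha> a b \<in> carrier (free_Abelian_group (nanowords \<alpha> // nanoword_iso \<alpha>))"
  using assms
  by (auto simp: interlaced_def nanoword_gen_def labelled_def nanowords_def gauss_word_def intro!: quotientI)

lemma coordinate_interlaced: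
  assumes "a \<in> \<alpha>" "b \<in> \<alpha>"
  shows "coordinate c f (interlaced \<alpha> a b) = f a b"
proof -
  have "labelled (\<lambda>n. if n = 0 then a else b) [0,1,0,1] \<in> nanowords \<alpha>"
    using assms by (auto simp: labelled_def nanowords_def gauss_word_def)
  then show ?thesis
    unfolding interlaced_def by (simp add: coordinate_gen gauss_value_labelled)
qed

text \<open>The label map of a nanoword is extensional, so on the empty word it is constantly \<open>undefined\<close>.\<close>

definition empty_word :: "'a set \<Rightarrow> 'a nanoword set \<Rightarrow>\<^sub>0 int" where
  "empty_word \<alpha> = nanoword_gen \<alpha> ([], \<lambda>_. undefined)"

lemma empty_nanoword: "([], \<lambda>_. undefined) \<in> nanowords \<alpha>"
  by (simp add: nanowords_def gauss_word_def)

text \<open>The second relation applied inside \<open>AB C BA C\<close> and inside \<open>C AB C BA\<close>: the word with all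
  three letters has rank three and vanishes, and a letter \<open>C\<close> that separates the two pairs interlaces with
  whichever of \<open>A\<close> and \<open>B\<close> remains.\<close>

lemma interlaced_shift:
  assumes \<tau>: "involution_on \<alpha> \<tau>" and a: "a \<in> \<alpha>" and b: "b \<in> \<alpha>"
  shows interlaced_shift_left: "interlaced \<alpha> (\<tau> a) b + interlaced \<alpha> a b \<in> relation_subgroup \<alpha> \<tau> S"
    and interlaced_shift_right: "interlaced \<alpha> b (\<tau> a) + interlaced \<alpha> b a \<in> relation_subgroup \<alpha> \<tau> S"
proof -
  define p :: "nat \<Rightarrow> 'a" where "p = (\<lambda>n. if n = 0 then \<tau> a else if n = 1 then a else b)"
  let ?N = "relation_subgroup \<alpha> \<tau> S"
  have p: "p n \<in> \<alpha>" for n using assms by (auto simp: p_def involution_on_def)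
  have mem: "labelled p w \<in> nanowords \<alpha>" if "gauss_word w" for w
    using p that by (auto simp: labelled_def nanowords_def)
  have big: "nanoword_gen \<alpha> (labelled p w) \<in> ?N" if "gauss_word w" "card (set w) = 3" for w
    using mem[OF that(1)] that(2)
    by (intro relator_in_relation_subgroup rel4) (auto simp: nanoword_rank_def labelled_def)
  note sub = subgroup_diff[OF subgroup_relation_subgroup]
  have "nanoword_gen \<alpha> (labelled p ([] @ [0,1] @ [2] @ [1,0] @ [2]))
    + nanoword_gen \<alpha> (labelled p ([] @ [0] @ [2] @ [0] @ [2]))
    + nanoword_gen \<alpha> (labelled p ([] @ [1] @ [2] @ [1] @ [2])) \<in> ?N"
    by (intro relator_in_relation_subgroup rel2 mem) (auto simp: gauss_word_def p_def)
  from sub[OF this big[of "[0,1,2,1,0,2]"]]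
  show "interlaced \<alpha> (\<tau> a) b + interlaced \<alpha> a b \<in> ?N"
    using p[of 0] p[of 1] p[of 2] by (simp add: gauss_word_def nanoword_gen_interlaced card_insert_if) (simp add: p_def)
  have "nanoword_gen \<alpha> (labelled p ([2] @ [0,1] @ [2] @ [1,0] @ []))
    + nanoword_gen \<alpha> (labelled p ([2] @ [0] @ [2] @ [0] @ []))
    + nanoword_gen \<alpha> (labelled p ([2] @ [1] @ [2] @ [1] @ [])) \<in> ?N"
    by (intro relator_in_relation_subgroup rel2 mem) (auto simp: gauss_word_def p_def)
  from sub[OF this big[of "[2,0,1,2,1,0]"]]
  show "interlaced \<alpha> b (\<tau> a) + interlaced \<alpha> b a \<in> ?N"
    using p[of 0] p[of 1] p[of 2] by (simp add: gauss_word_def nanoword_gen_interlaced card_insert_if) (simp add: p_def)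
qed

text \<open>A Gauss word of rank at most two has at most four letters, and unless it is empty or
  \<open>ABAB\<close> it has two equal neighbours, so the first relation applies. In higher rank the last one
  does.\<close>

lemma not_interlaced_null:
  assumes N: "(w, p) \<in> nanowords \<alpha>" and w: "w \<noteq> []"
    and "\<And>A B. A \<noteq> B \<Longrightarrow> w \<noteq> [A,B,A,B]"
  shows "nanoword_gen \<alpha> (w, p) \<in> relation_subgroup \<alpha> \<tau> S"
proof (cases "card (set w) > 2")
  case True
  then show ?thesis using N
    by (intro relator_in_relation_subgroup rel4) (auto simp: nanoword_rank_def)
next
  case False
  have g: "count_list w A = 2" if "A \<in> set w" for A
    using N that by (auto simp: nanowords_def gauss_word_def)
  have "length w = 2 * card (set w)"
    using sum_count_set[of w "set w"] g by simp
  then have "length w = 2 \<or> length w = 4" using False w by (cases "card (set w)") auto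
  then have "\<exists>x A y. w = x @ [A,A] @ y"
  proof
    assume "length w = 2"
    then obtain A B where AB: "w = [A,B]" by (auto simp: length_Suc_conv numeral_eq_Suc)
    then have "w = [] @ [A,A] @ []" using g[of A] by (auto split: if_splits)
    then show ?thesis by blast
  next
    assume "length w = 4"
    then obtain A B C D where w4: "w = [A,B,C,D]" by (auto simp: length_Suc_conv numeral_eq_Suc)
    then have "A = B \<or> B = C \<or> C = D \<or> (A \<noteq> B \<and> A = C \<and> B = D)"
      using g[of A] g[of B] by (auto split: if_splits)
    then consider "A = B" | "B = C" | "C = D" using assms(3)[of A B] w4 by blast
    then show ?thesis
    proof cases
      case 1 then have "w = [] @ [A,A] @ [C,D]" using w4 by simp
      then show ?thesis by blast
    next
      case 2 then have "w = [A] @ [B,B] @ [D]" using w4 by simp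
      then show ?thesis by blast
    next
      case 3 then have "w = [A,B] @ [C,C] @ []" using w4 by simp
      then show ?thesis by blast
    qed
  qed
  then obtain x A y where xAy: "w = x @ [A,A] @ y" by blast
  have "restrict p (set w) = p"
    using N by (auto simp: nanowords_def PiE_def extensional_restrict)
  then have "labelled p (x @ [A,A] @ y) = (w, p)" unfolding labelled_def xAy[symmetric] by simp
  then show ?thesis
    using rel1[of p x A y \<alpha> \<tau> S] N by (intro relator_in_relation_subgroup) simp
qed

text \<open>The third relation with all surrounding words empty. Of its eight terms the two of rank
  three vanish, and so do \<open>AACC\<close>, \<open>BAAB\<close> and \<open>BCCB\<close>.\<close>

lemma interlaced_triangle:
  assumes abc: "(a, b, c) \<in> S" and \<alpha>: "a \<in> \<alpha>" "b \<in> \<alpha>" "c \<in> \<alpha>"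
  shows "interlaced \<alpha> a b + interlaced \<alpha> b c - interlaced \<alpha> a c \<in> relation_subgroup \<alpha> \<tau> S"
proof -
  let ?N = "relation_subgroup \<alpha> \<tau> S"
  note N = subgroup_relation_subgroup[of \<alpha> \<tau> S]
  define p :: "nat \<Rightarrow> 'a" where "p = (\<lambda>n. if n = 0 then a else if n = 1 then b else c)"
  have p: "p n \<in> \<alpha>" for n using \<alpha> by (auto simp: p_def)
  define G where "G w = nanoword_gen \<alpha> (labelled p w)" for w
  have mem: "labelled p w \<in> nanowords \<alpha>" if "gauss_word w" for w
    using p that by (auto simp: labelled_def nanowords_def)
  have null: "G w \<in> ?N" if "gauss_word w" "w \<noteq> []" "\<And>A B. A \<noteq> B \<Longrightarrow> w \<noteq> [A,B,A,B]" for w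
    using not_interlaced_null[of w "restrict p (set w)" \<alpha> \<tau> S] mem[OF that(1)] that(2,3)
    by (simp add: labelled_def G_def)
  have "(G ([] @ [0,1] @ [] @ [0,2] @ [] @ [1,2] @ []) + G ([] @ [0,1] @ [] @ [0] @ [] @ [1] @ [])
      + G ([] @ [0] @ [] @ [0,2] @ [] @ [2] @ []) + G ([] @ [1] @ [] @ [2] @ [] @ [1,2] @ []))
    - (G ([] @ [1,0] @ [] @ [2,0] @ [] @ [2,1] @ []) + G ([] @ [1,0] @ [] @ [0] @ [] @ [1] @ [])
      + G ([] @ [0] @ [] @ [2,0] @ [] @ [2] @ []) + G ([] @ [1] @ [] @ [2] @ [] @ [2,1] @ [])) \<in> ?N"
    unfolding G_def using abc
    by (intro relator_in_relation_subgroup rel3 mem) (auto simp: gauss_word_def p_def)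
  then have rel: "(G [0,1,0,2,1,2] + G [0,1,0,1] + G [0,0,2,2] + G [1,2,1,2])
    - (G [1,0,2,0,2,1] + G [1,0,0,1] + G [0,2,0,2] + G [1,2,2,1]) \<in> ?N" by simp
  have "G [0,1,0,2,1,2] \<in> ?N" "G [0,0,2,2] \<in> ?N" "G [1,0,2,0,2,1] \<in> ?N"
    "G [1,0,0,1] \<in> ?N" "G [1,2,2,1] \<in> ?N"
    by (auto intro!: null simp: gauss_word_def)
  then have "(G [1,0,2,0,2,1] + G [1,0,0,1] + G [1,2,2,1])
      - (G [0,1,0,2,1,2] + G [0,0,2,2]) \<in> ?N"
    by (intro subgroup_diff[OF N] subgroup_add[OF N])
  from subgroup_add[OF N rel this]
  have "G [0,1,0,1] + G [1,2,1,2] - G [0,2,0,2] \<in> ?N" by (simp add: algebra_simps)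
  then show ?thesis
    using p[of 0] p[of 1] p[of 2] by (simp add: G_def nanoword_gen_interlaced) (simp add: p_def)
qed

lemma interlaced_diagonal:
  assumes "(a, a, a) \<in> S" "a \<in> \<alpha>"
  shows "interlaced \<alpha> a a \<in> relation_subgroup \<alpha> \<tau> S"
  using interlaced_triangle[OF assms(1)] assms(2) by simp

text \<open>The pairs in \<open>P\<close> index the free and those in \<open>Q\<close> the torsion part of a basis formed by
  classes of \<open>ABAB\<close>. The empty word adds one more free basis element, whose coordinate vanishes on every
  non-empty word and hence on all relators.\<close>

lemma G2_iso_of_coordinates:
  fixes f :: "'a \<times> 'a \<Rightarrow> 'a \<Rightarrow> 'a \<Rightarrow> int"
  assumes fin: "finite P" "finite Q" and disj: "P \<inter> Q = {}" and sub: "P \<union> Q \<subseteq> \<alpha> \<times> \<alpha>"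
    and P: "\<And>q. q \<in> P \<Longrightarrow> respects_moves \<alpha> \<tau> S 0 (f q)"
    and Q: "\<And>q. q \<in> Q \<Longrightarrow> respects_moves \<alpha> \<tau> S 2 (f q)"
    and dual: "\<And>q a b. q \<in> P \<union> Q \<Longrightarrow> (a, b) \<in> P \<union> Q \<Longrightarrow> f q a b = of_bool (q = (a, b))"
    and expand: "\<And>a b. a \<in> \<alpha> \<Longrightarrow> b \<in> \<alpha> \<Longrightarrow>
      interlaced \<alpha> a b - (\<Sum>q\<in>P \<union> Q. frag_cmul (f q a b) (interlaced \<alpha> (fst q) (snd q)))
        \<in> relation_subgroup \<alpha> \<tau> S"
    and torsion: "\<And>a b. (a, b) \<in> Q \<Longrightarrow> frag_cmul 2 (interlaced \<alpha> a b) \<in> relation_subgroup \<alpha> \<tau> S"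
  shows "G2 \<alpha> \<tau> S \<cong> Z_Z2_sum (card P + 1) (card Q)"
proof -
  let ?B = "nanowords \<alpha> // nanoword_iso \<alpha>" and ?N = "relation_subgroup \<alpha> \<tau> S"
  define \<phi> where "\<phi> i = (case i of None \<Rightarrow> coordinate 1 (\<lambda>_ _. 0) | Some q \<Rightarrow> coordinate 0 (f q))" for i
  define g where "g i = (case i of None \<Rightarrow> empty_word \<alpha> | Some q \<Rightarrow> interlaced \<alpha> (fst q) (snd q))" for i
  let ?I = "insert None (Some ` P)" and ?J = "Some ` Q"
  have add: "\<phi> i (x + y) = \<phi> i x + \<phi> i y" for i x y
    by (simp add: \<phi>_def coordinate_add split: option.split)
  have gcarr: "g i \<in> carrier (free_Abelian_group ?B)" if "i \<in> ?I \<union> ?J" for i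
    using that sub empty_nanoword[of \<alpha>] interlaced_carrier[of _ \<alpha>]
    by (auto simp: g_def empty_word_def nanoword_gen_def intro!: quotientI split: option.splits)
  have null: "respects_moves \<alpha> \<tau> S 0 (\<lambda>_ _. 0)" by (simp add: respects_moves_def)
  have empty: "coordinate c h (empty_word \<alpha>) = c" for c h
    unfolding empty_word_def coordinate_gen[OF empty_nanoword] by (simp add: gauss_value_def)
  have expand_gen: "frag_of C - (\<Sum>i\<in>?I \<union> ?J. frag_cmul (\<phi> i (frag_of C)) (g i)) \<in> ?N"
    if CB: "C \<in> ?B" for C
  proof -
    from CB obtain M where M: "M \<in> nanowords \<alpha>" "C = nanoword_iso \<alpha> `` {M}"
      by (rule quotientE)
    obtain w p where wp: "M = (w, p)" by (cases M)
    have N: "(w, p) \<in> nanowords \<alpha>" and C: "frag_of C = nanoword_gen \<alpha> (w, p)"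
      using M by (simp_all add: wp nanoword_gen_def)
    have \<phi>: "\<phi> None (frag_of C) = gauss_value 1 (\<lambda>_ _. 0) (w, p)"
      "\<phi> (Some q) (frag_of C) = gauss_value 0 (f q) (w, p)" for q
      by (simp_all add: \<phi>_def C coordinate_gen[OF N])
    have sum: "(\<Sum>i\<in>?I \<union> ?J. frag_cmul (\<phi> i (frag_of C)) (g i)) =
      frag_cmul (gauss_value 1 (\<lambda>_ _. 0) (w, p)) (empty_word \<alpha>)
      + (\<Sum>q\<in>P \<union> Q. frag_cmul (gauss_value 0 (f q) (w, p)) (interlaced \<alpha> (fst q) (snd q)))"
      using fin by (simp add: \<phi> g_def sum.reindex flip: image_Un)
    consider "w = []" | A B where "A \<noteq> B" "w = [A,B,A,B]"
      | "w \<noteq> []" "\<And>A B. A \<noteq> B \<Longrightarrow> w \<noteq> [A,B,A,B]" by blast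
    then show ?thesis
    proof cases
      case 1
      then have "p = (\<lambda>_. undefined)" using N by (simp add: nanowords_def)
      then have "frag_of C = empty_word \<alpha>" using 1 by (simp add: C empty_word_def)
      then show ?thesis
        unfolding sum using 1 subgroup_zero[OF subgroup_relation_subgroup]
        by (simp add: gauss_value_def)
    next
      case 2
      have p: "p A \<in> \<alpha>" "p B \<in> \<alpha>" and "labelled p w = (w, p)"
        using N 2 by (auto simp: nanowords_def labelled_def PiE_def extensional_restrict)
      then have "frag_of C = interlaced \<alpha> (p A) (p B)"
        using nanoword_gen_interlaced[OF 2(1), of p \<alpha>] 2 by (simp add: C)
      then show ?thesis
        unfolding sum using 2 expand[OF p] by (simp add: gauss_value_def)
    next
      case 3
      have g4: "\<not> (length w = 4 \<and> w ! 0 = w ! 2 \<and> w ! 1 = w ! 3)"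
      proof
        assume *: "length w = 4 \<and> w ! 0 = w ! 2 \<and> w ! 1 = w ! 3"
        then obtain A B where AB: "w = [A,B,A,B]" by (auto simp: length_Suc_conv numeral_eq_Suc)
        moreover have "count_list w A = 2" using N AB by (auto simp: nanowords_def gauss_word_def)
        ultimately have "A \<noteq> B" by auto
        then show False using 3 AB by blast
      qed
      have "gauss_value c h (w, p) = 0" for c h
        unfolding gauss_value_def using g4 3(1) by auto
      then show ?thesis
        unfolding sum using not_interlaced_null[OF N 3, of \<tau> S] by (simp add: C)
    qed
  qed
  have expand_all: "x - (\<Sum>i\<in>?I \<union> ?J. frag_cmul (\<phi> i x) (g i)) \<in> ?N"
    if "Poly_Mapping.keys x \<subseteq> ?B" for x
  proof (rule free_Abelian_group_induct[OF that])
    show "0 - (\<Sum>i\<in>?I \<union> ?J. frag_cmul (\<phi> i 0) (g i)) \<in> ?N"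
      using subgroup_zero[OF subgroup_relation_subgroup]
      by (simp add: additive_zero[where h = "\<phi> _", OF add])
  next
    fix x y
    assume xy: "x - (\<Sum>i\<in>?I \<union> ?J. frag_cmul (\<phi> i x) (g i)) \<in> ?N"
      "y - (\<Sum>i\<in>?I \<union> ?J. frag_cmul (\<phi> i y) (g i)) \<in> ?N"
    have eq: "(\<Sum>i\<in>?I \<union> ?J. frag_cmul (\<phi> i (x - y)) (g i)) =
      (\<Sum>i\<in>?I \<union> ?J. frag_cmul (\<phi> i x) (g i)) - (\<Sum>i\<in>?I \<union> ?J. frag_cmul (\<phi> i y) (g i))"
      by (simp only: additive_diff[where h = "\<phi> _", OF add] frag_cmul_diff_distrib sum_subtractf)
    show "x - y - (\<Sum>i\<in>?I \<union> ?J. frag_cmul (\<phi> i (x - y)) (g i)) \<in> ?N"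
      unfolding eq
      using subgroup_diff[OF subgroup_relation_subgroup xy] by (simp only: algebra_simps)
  qed (rule expand_gen)
  have "free_Abelian_group ?B Mod ?N \<cong> Z_Z2_sum (card ?I) (card ?J)"
  proof (rule quotient_iso_Z_Z2_sum[where \<phi> = \<phi> and g = g, OF subgroup_relation_subgroup])
    show "finite ?I" "finite ?J" "?I \<inter> ?J = {}" using fin disj by auto
    show "\<phi> i (g j) = of_bool (i = j)" if "i \<in> ?I \<union> ?J" "j \<in> ?I \<union> ?J" for i j
    proof (cases j)
      case None
      then show ?thesis by (auto simp: \<phi>_def g_def empty split: option.split)
    next
      case (Some q)
      then have q: "q \<in> P \<union> Q" and "fst q \<in> \<alpha>" "snd q \<in> \<alpha>" using that(2) sub by auto
      then show ?thesis
        using that(1) dual[of _ "fst q" "snd q"]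
        by (auto simp: Some \<phi>_def g_def coordinate_interlaced)
    qed
    show "\<phi> i x = 0" if "i \<in> ?I" "x \<in> ?N" for i x
      using that coordinate_relation_subgroup[OF null] coordinate_relation_subgroup[OF P]
      by (auto simp: \<phi>_def)
    show "even (\<phi> j x)" if "j \<in> ?J" "x \<in> ?N" for j x
      using that coordinate_relation_subgroup[OF Q] by (auto simp: \<phi>_def)
    show "frag_cmul 2 (g j) \<in> ?N" if "j \<in> ?J" for j
      using that torsion by (auto simp: g_def)
  qed (use add gcarr expand_all in auto)
  moreover have "card ?I = card P + 1" "card ?J = card Q"
    using fin by (auto simp: card_insert_if card_image)
  ultimately show ?thesis by (simp add: G2_def relation_subgroup_def nanoword_free_group_def)
qed

section \<open>Representatives of the orbits\<close>

text \<open>The choice depends on the set \<open>{a, \<tau> a}\<close> only, which makes it the same for both points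
  of an orbit.\<close>

definition orbit_rep :: "('a \<Rightarrow> 'a) \<Rightarrow> 'a \<Rightarrow> 'a" where
  "orbit_rep \<tau> a = (SOME x. x \<in> {a, \<tau> a})"

text \<open>A letter label \<open>a\<close> contributes \<open>orbit_sign \<tau> a\<close> times its representative, since
  the relations identify \<open>\<tau> a\<close> with \<open>- a\<close> in each argument.\<close>

definition orbit_sign :: "('a \<Rightarrow> 'a) \<Rightarrow> 'a \<Rightarrow> int" where
  "orbit_sign \<tau> a = (if orbit_rep \<tau> a = a then 1 else - 1)"

definition free_reps :: "'a set \<Rightarrow> ('a \<Rightarrow> 'a) \<Rightarrow> 'a set" where
  "free_reps \<alpha> \<tau> = {a \<in> \<alpha>. \<tau> a \<noteq> a \<and> orbit_rep \<tau> a = a}"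

definition fixed_reps :: "'a set \<Rightarrow> ('a \<Rightarrow> 'a) \<Rightarrow> 'a set" where
  "fixed_reps \<alpha> \<tau> = {a \<in> \<alpha>. \<tau> a = a}"

definition reps :: "'a set \<Rightarrow> ('a \<Rightarrow> 'a) \<Rightarrow> 'a set" where
  "reps \<alpha> \<tau> = free_reps \<alpha> \<tau> \<union> fixed_reps \<alpha> \<tau>"

lemma orbit_rep_cases: "orbit_rep \<tau> a = a \<or> orbit_rep \<tau> a = \<tau> a"
proof -
  have "orbit_rep \<tau> a \<in> {a, \<tau> a}" unfolding orbit_rep_def by (rule someI[of _ a]) simp
  then show ?thesis by simp
qed

lemma orbit_rep_cong: "{a, \<tau> a} = {b, \<tau> b} \<Longrightarrow> orbit_rep \<tau> a = orbit_rep \<tau> b"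
  by (simp add: orbit_rep_def)

lemma card_fixed_reps: "card (fixed_reps \<alpha> \<tau>) = card (fixed_orbits \<alpha> \<tau>)"
proof -
  have "fixed_orbits \<alpha> \<tau> = (\<lambda>a. {a}) ` fixed_reps \<alpha> \<tau>"
    by (auto simp: fixed_orbits_def fixed_reps_def)
  then show ?thesis by (simp add: card_image)
qed

lemma reps_normalized: "r \<in> reps \<alpha> \<tau> \<Longrightarrow> orbit_rep \<tau> r = r \<and> orbit_sign \<tau> r = 1 \<and> r \<in> \<alpha>"
  using orbit_rep_cases[of \<tau> r]
  by (auto simp: reps_def free_reps_def fixed_reps_def orbit_sign_def)

lemma reps_subset: "reps \<alpha> \<tau> \<subseteq> \<alpha>"
  by (auto simp: reps_def free_reps_def fixed_reps_def)

lemma free_fixed_disjoint: "free_reps \<alpha> \<tau> \<inter> fixed_reps \<alpha> \<tau> = {}"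
  by (auto simp: free_reps_def fixed_reps_def)

context
  fixes \<alpha> :: "'a set" and \<tau> :: "'a \<Rightarrow> 'a"
  assumes \<tau>: "involution_on \<alpha> \<tau>"
begin

lemma involution: "a \<in> \<alpha> \<Longrightarrow> \<tau> a \<in> \<alpha>" "a \<in> \<alpha> \<Longrightarrow> \<tau> (\<tau> a) = a"
  using \<tau> by (auto simp: involution_on_def)

lemma orbit_rep_involution: "a \<in> \<alpha> \<Longrightarrow> orbit_rep \<tau> (\<tau> a) = orbit_rep \<tau> a"
  by (intro orbit_rep_cong) (auto simp: involution)

lemma orbit_rep_in_reps: "a \<in> \<alpha> \<Longrightarrow> orbit_rep \<tau> a \<in> reps \<alpha> \<tau>"
  using orbit_rep_cases[of \<tau> a] orbit_rep_involution[of a] involution[of a]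
  by (auto simp: reps_def free_reps_def fixed_reps_def)

lemma orbit_sign_involution: "a \<in> \<alpha> \<Longrightarrow> \<tau> a \<noteq> a \<Longrightarrow> orbit_sign \<tau> (\<tau> a) = - orbit_sign \<tau> a"
  using orbit_rep_cases[of \<tau> a] orbit_rep_involution[of a] by (auto simp: orbit_sign_def)

lemma card_free_reps: "card (free_reps \<alpha> \<tau>) = card (free_orbits \<alpha> \<tau>)"
proof -
  have "inj_on (\<lambda>a. {a, \<tau> a}) (free_reps \<alpha> \<tau>)"
  proof (rule inj_onI)
    fix a b assume ab: "a \<in> free_reps \<alpha> \<tau>" "b \<in> free_reps \<alpha> \<tau>" "{a, \<tau> a} = {b, \<tau> b}"
    then show "a = b" using orbit_rep_cong[OF ab(3)] by (simp add: free_reps_def)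
  qed
  moreover have "free_orbits \<alpha> \<tau> = (\<lambda>a. {a, \<tau> a}) ` free_reps \<alpha> \<tau>"
  proof
    show "(\<lambda>a. {a, \<tau> a}) ` free_reps \<alpha> \<tau> \<subseteq> free_orbits \<alpha> \<tau>"
    proof (rule image_subsetI)
      fix a assume "a \<in> free_reps \<alpha> \<tau>"
      then have "a \<in> \<alpha>" "a \<noteq> \<tau> a" by (auto simp: free_reps_def)
      then show "{a, \<tau> a} \<in> free_orbits \<alpha> \<tau>" unfolding free_orbits_def by blast
    qed
    show "free_orbits \<alpha> \<tau> \<subseteq> (\<lambda>a. {a, \<tau> a}) ` free_reps \<alpha> \<tau>"
    proof
      fix O' assume "O' \<in> free_orbits \<alpha> \<tau>"
      then obtain a where a: "a \<in> \<alpha>" "a \<noteq> \<tau> a" "O' = {a, \<tau> a}"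
        unfolding free_orbits_def by blast
      have "orbit_rep \<tau> a \<in> free_reps \<alpha> \<tau>"
        using a(1,2) orbit_rep_cases[of \<tau> a] orbit_rep_involution[OF a(1)] involution[OF a(1)]
        by (auto simp: free_reps_def)
      moreover have "O' = {orbit_rep \<tau> a, \<tau> (orbit_rep \<tau> a)}"
        using orbit_rep_cases[of \<tau> a]
        by (elim disjE) (simp_all add: a(3) involution[OF a(1)] insert_commute)
      ultimately show "O' \<in> (\<lambda>a. {a, \<tau> a}) ` free_reps \<alpha> \<tau>" by blast
    qed
  qed
  ultimately show ?thesis by (simp add: card_image)
qed

section \<open>The groups for the three choices of relation set\<close>

text \<open>One argument after the other is moved to its representative by a shift relation, which costs a sign
  when the representative is the other point of the orbit.\<close>

lemma interlaced_rep:
  assumes a: "a \<in> \<alpha>" and b: "b \<in> \<alpha>"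
  shows "interlaced \<alpha> a b - frag_cmul (orbit_sign \<tau> a * orbit_sign \<tau> b)
      (interlaced \<alpha> (orbit_rep \<tau> a) (orbit_rep \<tau> b)) \<in> relation_subgroup \<alpha> \<tau> S"
proof -
  let ?N = "relation_subgroup \<alpha> \<tau> S"
  let ?X = "interlaced \<alpha>" and ?s = "orbit_sign \<tau>" and ?r = "orbit_rep \<tau>"
  note N = subgroup_relation_subgroup[of \<alpha> \<tau> S]
  have left: "?X a b - frag_cmul (?s a) (?X (?r a) b) \<in> ?N"
    using interlaced_shift_left[OF \<tau> a b] orbit_rep_cases[of \<tau> a] subgroup_zero[OF N]
    by (auto simp: orbit_sign_def add.commute)
  have ra: "?r a \<in> \<alpha>" using reps_normalized[OF orbit_rep_in_reps[OF a]] by simp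
  have right: "?X (?r a) b - frag_cmul (?s b) (?X (?r a) (?r b)) \<in> ?N"
    using interlaced_shift_right[OF \<tau> b ra] orbit_rep_cases[of \<tau> b] subgroup_zero[OF N]
    by (auto simp: orbit_sign_def add.commute)
  have "?X a b - frag_cmul (?s a * ?s b) (?X (?r a) (?r b))
    = (?X a b - frag_cmul (?s a) (?X (?r a) b))
      + frag_cmul (?s a) (?X (?r a) b - frag_cmul (?s b) (?X (?r a) (?r b)))"
    by (rule poly_mapping_eqI) (simp add: lookup_add lookup_minus algebra_simps)
  then show ?thesis using subgroup_add[OF N left subgroup_cmul[OF N right]] by metis
qed

text \<open>The pairs of representatives outside \<open>E\<close> form a basis: the triangle relations of a diagonal
  \<open>S\<close> only kill pairs in \<open>E\<close>, and all of \<open>E\<close> is killed. A pair of free representatives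
  gives an element of infinite order. If one of the two is fixed by \<open>\<tau>\<close>, then the shift relation
  in that argument says that twice the basis element is zero. The coordinate of \<open>X a b\<close> at the pair of
  representatives is the product of the two signs.\<close>

lemma G2_iso_signed:
  fixes E :: "('a \<times> 'a) set"
  defines "F \<equiv> free_reps \<alpha> \<tau>" and "R \<equiv> reps \<alpha> \<tau>"
  assumes fin: "finite \<alpha>"
    and S: "\<And>a b c. a \<in> \<alpha> \<Longrightarrow> b \<in> \<alpha> \<Longrightarrow> c \<in> \<alpha> \<Longrightarrow> (a, b, c) \<in> S \<Longrightarrow>
      a = b \<and> b = c \<and> (orbit_rep \<tau> a, orbit_rep \<tau> a) \<in> E"
    and E: "\<And>r s. (r, s) \<in> E \<Longrightarrow> interlaced \<alpha> r s \<in> relation_subgroup \<alpha> \<tau> S"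
  shows "G2 \<alpha> \<tau> S \<cong> Z_Z2_sum (card (F \<times> F - E) + 1) (card ((R \<times> R - F \<times> F) - E))"
proof -
  let ?N = "relation_subgroup \<alpha> \<tau> S"
  note N = subgroup_relation_subgroup[of \<alpha> \<tau> S]
  let ?P = "F \<times> F - E" and ?Q = "(R \<times> R - F \<times> F) - E"
  let ?r = "orbit_rep \<tau>" and ?s = "orbit_sign \<tau>"
  define f where "f q a b = (if q = (?r a, ?r b) then ?s a * ?s b else 0)" for q a b
  have FR: "F \<subseteq> R" by (auto simp: F_def R_def reps_def)
  have PQ: "?P \<union> ?Q = R \<times> R - E" using FR by auto
  have R\<alpha>: "R \<subseteq> \<alpha>" unfolding R_def by (rule reps_subset)
  have finR: "finite R" using finite_subset[OF R\<alpha> fin] .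
  have fixed: "?r a = a \<and> a \<notin> F" if "\<tau> a = a" for a
    using that orbit_rep_cases[of \<tau> a] by (auto simp: F_def free_reps_def)
  have resp: "respects_moves \<alpha> \<tau> S d (f q)"
    if "q \<notin> E" and d: "q \<in> F \<times> F \<or> d = 2" for q d
    unfolding respects_moves_def
  proof (intro conjI ballI impI)
    fix a b assume a: "a \<in> \<alpha>" and b: "b \<in> \<alpha>"
    \<comment> \<open>At a fixed point the two summands agree, and if they are non-zero then \<open>q\<close> has a fixed entry,
      so the modulus is two; at any other point the sign flips and they cancel.\<close>
    have *: "(\<tau> a = a \<and> (q = (a, ?r b) \<or> q = (?r b, a) \<longrightarrow> d = 2)) \<or> ?s (\<tau> a) = - ?s a"
      using d fixed[of a] orbit_sign_involution[OF a] by auto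
    then show "d dvd f q (\<tau> a) b + f q a b" "d dvd f q b (\<tau> a) + f q b a"
      using orbit_rep_involution[OF a] fixed[of a] by (auto simp: f_def)
  next
    fix a b c assume "a \<in> \<alpha>" "b \<in> \<alpha>" "c \<in> \<alpha>" "(a, b, c) \<in> S"
    then show "d dvd f q a b + f q b c - f q a c"
      using S[of a b c] that(1) by (auto simp: f_def)
  qed
  show ?thesis
  proof (rule G2_iso_of_coordinates[where f = f])
    show "finite ?P" "finite ?Q" using finR finite_subset[OF FR] by auto
    show "?P \<inter> ?Q = {}" by auto
    show "?P \<union> ?Q \<subseteq> \<alpha> \<times> \<alpha>" unfolding PQ using R\<alpha> by auto
    show "respects_moves \<alpha> \<tau> S 0 (f q)" if "q \<in> ?P" for q using that resp by auto
    show "respects_moves \<alpha> \<tau> S 2 (f q)" if "q \<in> ?Q" for q using that resp by auto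
    show "f q a b = of_bool (q = (a, b))" if "(a, b) \<in> ?P \<union> ?Q" for q a b
      using that reps_normalized[of a \<alpha> \<tau>] reps_normalized[of b \<alpha> \<tau>] unfolding PQ
      by (auto simp: f_def R_def)
    show "interlaced \<alpha> a b - (\<Sum>q\<in>?P \<union> ?Q. frag_cmul (f q a b) (interlaced \<alpha> (fst q) (snd q))) \<in> ?N"
      if a: "a \<in> \<alpha>" and b: "b \<in> \<alpha>" for a b
    proof -
      let ?y = "frag_cmul (?s a * ?s b) (interlaced \<alpha> (?r a) (?r b))"
      have "(\<Sum>q\<in>?P \<union> ?Q. frag_cmul (f q a b) (interlaced \<alpha> (fst q) (snd q)))
          = (\<Sum>q\<in>R \<times> R - E. if q = (?r a, ?r b) then ?y else 0)"
        unfolding PQ by (intro sum.cong) (auto simp: f_def)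
      also have "\<dots> = (if (?r a, ?r b) \<in> E then 0 else ?y)"
        using finR orbit_rep_in_reps[OF a] orbit_rep_in_reps[OF b] by (auto simp: sum.delta R_def)
      finally have sum: "(\<Sum>q\<in>?P \<union> ?Q. frag_cmul (f q a b) (interlaced \<alpha> (fst q) (snd q)))
          = (if (?r a, ?r b) \<in> E then 0 else ?y)" .
      have y: "interlaced \<alpha> a b - ?y \<in> ?N" by (rule interlaced_rep[OF a b])
      show ?thesis
      proof (cases "(?r a, ?r b) \<in> E")
        case True
        from subgroup_add[OF N y subgroup_cmul[OF N E[OF True], of "?s a * ?s b"]]
        have "interlaced \<alpha> a b \<in> ?N" by simp
        then show ?thesis unfolding sum using True by simp
      next
        case False
        then show ?thesis unfolding sum using y by simp
      qed
    qed
    show "frag_cmul 2 (interlaced \<alpha> a b) \<in> ?N" if "(a, b) \<in> ?Q" for a b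
    proof -
      have "a \<in> \<alpha>" "b \<in> \<alpha>" "\<tau> a = a \<or> \<tau> b = b"
        using that R\<alpha> by (auto simp: R_def F_def reps_def fixed_reps_def)
      then show ?thesis
        unfolding frag_cmul_2
        using interlaced_shift_left[OF \<tau>, of a b S] interlaced_shift_right[OF \<tau>, of b a S] by auto
    qed
  qed
qed

text \<open>Over the full relation set, \<open>X a b\<close> is a difference of the values \<open>X z b\<close> and
  \<open>X z a\<close> at a base point. Twice any of those is zero, so signs disappear and the coordinate at a
  representative \<open>r\<close> counts how many of \<open>a\<close>, \<open>b\<close> lie in the orbit of
  \<open>r\<close>. The pair \<open>(z, z)\<close> contributes nothing, as \<open>X z z = 0\<close>.\<close>

lemma G2_iso_full:
  assumes fin: "finite \<alpha>" and base: "z \<in> reps \<alpha> \<tau>"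
  shows "G2 \<alpha> \<tau> (\<alpha> \<times> \<alpha> \<times> \<alpha>) \<cong> Z_Z2_sum 1 (card (reps \<alpha> \<tau>) - 1)"
proof -
  let ?S = "\<alpha> \<times> \<alpha> \<times> \<alpha>"
  let ?N = "relation_subgroup \<alpha> \<tau> ?S"
  note N = subgroup_relation_subgroup[of \<alpha> \<tau> ?S]
  let ?X = "interlaced \<alpha>" and ?r = "orbit_rep \<tau>"
  define R where "R = reps \<alpha> \<tau>"
  define Q where "Q = {z} \<times> (R - {z})"
  have R\<alpha>: "R \<subseteq> \<alpha>" unfolding R_def by (rule reps_subset)
  have finR: "finite R" using finite_subset[OF R\<alpha> fin] .
  have z: "z \<in> \<alpha>" using base R\<alpha> by (auto simp: R_def)
  define f :: "'a \<times> 'a \<Rightarrow> 'a \<Rightarrow> 'a \<Rightarrow> int"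
    where "f q a b = of_bool (?r a = snd q) + of_bool (?r b = snd q)" for q a b
  have triangle: "?X a b + ?X b c - ?X a c \<in> ?N" if "a \<in> \<alpha>" "b \<in> \<alpha>" "c \<in> \<alpha>" for a b c
    by (rule interlaced_triangle) (use that in auto)
  have shift: "?X z (\<tau> a) + ?X z a \<in> ?N" if "a \<in> \<alpha>" for a
    by (rule interlaced_shift_right[OF \<tau> that z])
  have twice: "?X z a + ?X z a \<in> ?N" if a: "a \<in> \<alpha>" for a
  proof -
    \<comment> \<open>The triangles through \<open>z\<close> and \<open>a\<close> with third vertex \<open>\<tau> a\<close> and \<open>a\<close>;
      the shift relations remove every term except the two copies of \<open>X z a\<close>.\<close>
    have "(?X z a + ?X a (\<tau> a) - ?X z (\<tau> a)) + (?X z a + ?X a a - ?X z a)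
        - (?X a (\<tau> a) + ?X a a) + (?X z (\<tau> a) + ?X z a) \<in> ?N"
      by (intro subgroup_add[OF N] subgroup_diff[OF N] triangle shift interlaced_shift_right[OF \<tau>])
        (use a z involution in auto)
    then show ?thesis by (simp add: algebra_simps)
  qed
  \<comment> \<open>The normal form of \<open>X z a\<close> in the basis indexed by \<open>Q\<close>.\<close>
  define Y where "Y a = (if ?r a = z then 0 else ?X z (?r a))" for a
  have XY: "?X z a - Y a \<in> ?N" if a: "a \<in> \<alpha>" for a
  proof -
    have "?X z a - ?X z (?r a) \<in> ?N"
    proof (cases "?r a = a")
      case True then show ?thesis using subgroup_zero[OF N] by simp
    next
      case False
      then have "?r a = \<tau> a" using orbit_rep_cases[of \<tau> a] by simp
      moreover have "(?X z (\<tau> a) + ?X z a) - (?X z (\<tau> a) + ?X z (\<tau> a)) \<in> ?N"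
        by (intro subgroup_diff[OF N] shift twice) (use a involution in auto)
      ultimately show ?thesis by simp
    qed
    moreover have "?X z z \<in> ?N" by (rule interlaced_diagonal) (use z in auto)
    ultimately show ?thesis
      using subgroup_add[OF N] by (fastforce simp: Y_def)
  qed
  have "G2 \<alpha> \<tau> ?S \<cong> Z_Z2_sum (card ({} :: ('a \<times> 'a) set) + 1) (card Q)"
  proof (rule G2_iso_of_coordinates[where f = f])
    show "finite Q" using finR by (simp add: Q_def)
    show "{} \<union> Q \<subseteq> \<alpha> \<times> \<alpha>" using R\<alpha> z by (auto simp: Q_def)
    show "respects_moves \<alpha> \<tau> ?S 2 (f q)" for q
      by (auto simp: respects_moves_def f_def orbit_rep_involution)
    show "f q a b = of_bool (q = (a, b))" if "q \<in> {} \<union> Q" "(a, b) \<in> {} \<union> Q" for q a b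
      using that reps_normalized[of a \<alpha> \<tau>] reps_normalized[of b \<alpha> \<tau>] base
      by (auto simp: f_def Q_def R_def)
    show "frag_cmul 2 (?X a b) \<in> ?N" if "(a, b) \<in> Q" for a b
      using that twice R\<alpha> by (auto simp: Q_def frag_cmul_2)
    show "?X a b - (\<Sum>q\<in>{} \<union> Q. frag_cmul (f q a b) (?X (fst q) (snd q))) \<in> ?N"
      if a: "a \<in> \<alpha>" and b: "b \<in> \<alpha>" for a b
    proof -
      have Ysum: "(\<Sum>r\<in>R - {z}. frag_cmul (of_bool (?r c = r)) (?X z r)) = Y c" if "c \<in> \<alpha>" for c
      proof -
        have "(\<Sum>r\<in>R - {z}. frag_cmul (of_bool (?r c = r)) (?X z r))
            = (\<Sum>r\<in>R - {z}. if ?r c = r then ?X z r else 0)"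
          by (intro sum.cong) auto
        also have "\<dots> = Y c"
          using finR orbit_rep_in_reps[OF that] by (auto simp: Y_def R_def sum.delta)
        finally show ?thesis .
      qed
      have "(\<Sum>q\<in>{} \<union> Q. frag_cmul (f q a b) (?X (fst q) (snd q)))
          = (\<Sum>r\<in>R - {z}. frag_cmul (f (z, r) a b) (?X z r))"
        by (simp add: Q_def sum.cartesian_product' flip: sum.cartesian_product)
      also have "\<dots> = Y a + Y b"
        by (simp only: f_def snd_conv frag_cmul_distrib sum.distrib Ysum[OF a] Ysum[OF b])
      finally have sum: "(\<Sum>q\<in>{} \<union> Q. frag_cmul (f q a b) (?X (fst q) (snd q))) = Y a + Y b" .
      have "Y a + Y a \<in> ?N"
        using subgroup_zero[OF N] twice orbit_rep_in_reps[OF a] R\<alpha> by (auto simp: Y_def R_def)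
      \<comment> \<open>The triangle gives \<open>Y b - Y a\<close>; the sign of \<open>Y a\<close> is corrected by \<open>2 Y a = 0\<close>.\<close>
      moreover have "?X z a + ?X a b - ?X z b \<in> ?N" by (rule triangle) (use a b z in auto)
      ultimately have "(?X z a + ?X a b - ?X z b) + (?X z b - Y b) - (?X z a - Y a) - (Y a + Y a) \<in> ?N"
        using subgroup_diff[OF N subgroup_diff[OF N subgroup_add[OF N _ XY[OF b]] XY[OF a]]] by blast
      then show ?thesis unfolding sum by (simp add: algebra_simps)
    qed
  qed auto
  moreover have "card Q = card R - 1"
    using base by (simp add: Q_def R_def card_cartesian_product)
  ultimately show ?thesis by (simp add: R_def)
qed

end

theorem theorem7p4:
  fixes \<alpha> :: "'a set" and \<tau> :: "'a \<Rightarrow> 'a" and l k :: nat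
  assumes "finite \<alpha>" and "\<alpha> \<noteq> {}"
    and "involution_on \<alpha> \<tau>"
    and "l = card (free_orbits \<alpha> \<tau>)"
    and "k = card (fixed_orbits \<alpha> \<tau>)"
  shows "G2 \<alpha> \<tau> {} \<cong> Z_Z2_sum (l^2 + 1) (k^2 + 2*k*l)
    \<and> G2 \<alpha> \<tau> {(a, a, a) | a. a \<in> \<alpha>} \<cong> Z_Z2_sum (l^2 - l + 1) (k^2 + 2*k*l - k)
    \<and> G2 \<alpha> \<tau> (\<alpha> \<times> \<alpha> \<times> \<alpha>) \<cong> Z_Z2_sum 1 (k + l - 1)"
proof -
  note fin = assms(1) and \<tau> = assms(3)
  define F K R where "F = free_reps \<alpha> \<tau>" and "K = fixed_reps \<alpha> \<tau>" and "R = reps \<alpha> \<tau>"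
  have sub: "F \<subseteq> \<alpha>" "K \<subseteq> \<alpha>" by (auto simp: F_def K_def free_reps_def fixed_reps_def)
  have finFK: "finite F" "finite K" using finite_subset[OF sub(1) fin] finite_subset[OF sub(2) fin] .
  have card: "card F = l" "card K = k"
    using card_free_reps[OF \<tau>] card_fixed_reps[of \<alpha> \<tau>] assms(4,5) by (auto simp: F_def K_def)
  have R: "R = F \<union> K" "F \<inter> K = {}"
    using free_fixed_disjoint[of \<alpha> \<tau>] by (auto simp: F_def K_def R_def reps_def)
  have cardR: "card R = k + l" using R finFK card by (simp add: card_Un_disjoint)
  have cardFF: "card (F \<times> F) = l^2" using card by (simp add: card_cartesian_product power2_eq_square)
  have cardQ: "card (R \<times> R - F \<times> F) = k^2 + 2*k*l"
  proof -
    have "card (R \<times> R - F \<times> F) = card (R \<times> R) - card (F \<times> F)"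
      using R finFK by (intro card_Diff_subset) auto
    also have "\<dots> = k^2 + 2*k*l"
      by (simp add: card_cartesian_product cardR card power2_eq_square algebra_simps)
    finally show ?thesis .
  qed
  have card_Id: "card (Id_on A) = card A" for A :: "'a set"
  proof -
    have "Id_on A = (\<lambda>a. (a, a)) ` A" by auto
    then show ?thesis by (simp add: card_image inj_on_def)
  qed
  let ?D = "{(a, a, a) | a. a \<in> \<alpha>}"
  have "G2 \<alpha> \<tau> {} \<cong> Z_Z2_sum (card (F \<times> F - {}) + 1) (card ((R \<times> R - F \<times> F) - {}))"
    unfolding F_def R_def by (rule G2_iso_signed[OF \<tau> fin]) auto
  then have empty: "G2 \<alpha> \<tau> {} \<cong> Z_Z2_sum (l^2 + 1) (k^2 + 2*k*l)"
    by (simp add: cardFF cardQ)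
  have "G2 \<alpha> \<tau> ?D \<cong> Z_Z2_sum (card (F \<times> F - Id_on R) + 1) (card ((R \<times> R - F \<times> F) - Id_on R))"
    unfolding F_def R_def
  proof (rule G2_iso_signed[OF \<tau> fin])
    show "a = b \<and> b = c \<and> (orbit_rep \<tau> a, orbit_rep \<tau> a) \<in> Id_on (reps \<alpha> \<tau>)"
      if "a \<in> \<alpha>" "(a, b, c) \<in> ?D" for a b c
      using that orbit_rep_in_reps[OF \<tau>, of a] by auto
    show "interlaced \<alpha> r s \<in> relation_subgroup \<alpha> \<tau> ?D" if "(r, s) \<in> Id_on (reps \<alpha> \<tau>)" for r s
      using that reps_normalized[of r \<alpha> \<tau>] interlaced_diagonal[of r ?D \<alpha> \<tau>] by auto
  qed
  moreover have "card (F \<times> F - Id_on R) = l^2 - l"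
  proof -
    have "F \<times> F - Id_on R = F \<times> F - Id_on F" using R by auto
    also have "card \<dots> = card (F \<times> F) - card (Id_on F)"
      using finFK by (intro card_Diff_subset) (auto intro: finite_subset[of _ "F \<times> F"])
    finally show ?thesis by (simp add: cardFF card_Id card)
  qed
  moreover have "card ((R \<times> R - F \<times> F) - Id_on R) = k^2 + 2*k*l - k"
  proof -
    have "(R \<times> R - F \<times> F) - Id_on R = (R \<times> R - F \<times> F) - Id_on K" using R by auto
    also have "card \<dots> = card (R \<times> R - F \<times> F) - card (Id_on K)"
      using finFK R by (intro card_Diff_subset) (auto intro: finite_subset[of _ "K \<times> K"])
    finally show ?thesis by (simp add: cardQ card_Id card)
  qed
  ultimately have diagonal: "G2 \<alpha> \<tau> ?D \<cong> Z_Z2_sum (l^2 - l + 1) (k^2 + 2*k*l - k)" by simp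
  obtain a where "a \<in> \<alpha>" using assms(2) by blast
  from G2_iso_full[OF \<tau> fin orbit_rep_in_reps[OF \<tau> this]]
  have full: "G2 \<alpha> \<tau> (\<alpha> \<times> \<alpha> \<times> \<alpha>) \<cong> Z_Z2_sum 1 (k + l - 1)"
    by (simp add: cardR flip: R_def)
  show ?thesis using empty diagonal full by blast
qed

end
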